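(* Let $N=2k+1\ge3$ be odd, let $q\in\mathbb{C}^*$ be not a root of unity, and let $C_1\subset C_2$, $e\in C_1$, $u_1\in C_2$, the scalars $a,b,c,d$ and the trace $tr$ be as described in the context. The Markov property $tr(xg_n)=tr(x)tr(g_n)$ for $x\in C_n$ only holds if the matrix entries are as follows: if $a=c+1$, then $$a=\frac{[k](q^{1/2}+q^{-1/2})}{[k+1/2]},\qquad c=\frac{[k-1/2]}{[k+1/2]};$$ if $a=c-1$, then $$a=\frac{-(q^{1/2}-q^{-1/2})(q^k-q^{-k})}{q^{k+1/2}+q^{-k-1/2}},\qquad c=\frac{q^{k-1/2}+q^{-k+1/2}}{q^{k+1/2}+q^{-k-1/2}}.$$
   Context: $[x]=(q^x-q^{-x})/(q-q^{-1})$ for $x\in\frac12\mathbb{Z}$ (with a fixed square root $q^{1/2}$). The Hecke algebra $H_n(q)$ has generators $g_i$, $1\le i<n$, with braid relations and $g_i^2=(q-q^{-1})g_i+1$; $u_i=q-g_i$, so $u_i^2=[2]u_i$. $H_n^{(N)}$ is the image of $H_n(q)$ in its standard representation on $V^{\otimes n}$, $V=\mathbb{C}^N$; its Markov trace is the normalized trace whose value on a minimal idempotent of the block labeled by a Young diagram $\mu$ is $\dim_qV_\mu/[N]^n$, with $\dim_q V_\mu=\prod_{1\le i<j\le N}\frac{[\mu_i-\mu_j+j-i]}{[j-i]}$ the $q$-dimension of the simple $U_q\mathfrak{sl}_N$-module $V_\mu$; in particular $tr(u_1)=[N-1]/[N]$. One considers extensions $C_n\supset H_n^{(N)}$ with $C_n\subset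 C_{n+1}$ such that the inclusion $H^{(N)}_n\subset C_n$ has the same structure as $\mathrm{End}_{SL(N)}(V^{\otimes n})\subset\mathrm{End}_{Sp(N-1)}(V^{\otimes n})$, where $V=\mathbf 1\oplus V'$ as an $Sp(N-1)$-module. Let $e\in C_1$ be the projection onto the trivial representation. $C_2$ is semisimple; it has two nonisomorphic 2-dimensional irreducible representations (labeled by $\mathbf1$ and $V'$), and its remaining simple components (labeled by the diagrams $[2]$, and $[1,1]$ if $N\ge5$) are one-dimensional and $e$ acts on them as $0$. Bases are chosen such that on the two 2-dimensional representations $$e\mapsto\begin{pmatrix}1&0\\0&0\end{pmatrix}\oplus\begin{pmatrix}1&0\\0&0\end{pmatrix},\qquad u_1\mapsto\begin{pmatrix}a&\sqrt{ab}\\\sqrt{ab}&b\end{pmatrix}\oplus\begin{pmatrix}c&\sqrt{cd}\\\sqrt{cd}&d\end{pmatrix}.$$ $tr$ is a normalized trace on the $C_n$, compatible with the inclusions $C_n\subset C_{n+1}$, extending the Markov trace on $H_n^{(N)}$ with $tr(e)=1/[N]$. Its value on a minimal idempotent of $C_n$ labeled by $\lambda$ is $\dim_qV_\lambda/[N]^n$, with $\dim_qV_\lambda$ the $q$-dimension of the simple $U_q\mathfrak{sp}_{N-1}$-module; in particular its value on a minimal idempotent of $C_2$ is $1/[N]^2$ in the block labeled by $\mathbf1$ and $([N]-1)/[N]^2$ in the block labeled by $V'$. *)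

theory Defs
  imports Complex_Main "Jordan_Normal_Form.Determinant"
begin

section \<open>q-numbers with half-integral arguments\<close>

text \<open>Throughout, s is the fixed square root of q. For a half-integer x, the number q to the
  power x is the integral power s to the 2x; the value for other rational x is irrelevant.\<close>

definition qpow :: "complex \<Rightarrow> rat \<Rightarrow> complex" where
  "qpow s x = s powi \<lfloor>2 * x\<rfloor>"

definition qnum :: "complex \<Rightarrow> rat \<Rightarrow> complex" where
  "qnum s x = (qpow s x - qpow s (- x)) / (qpow s 1 - qpow s (- 1))"

section \<open>Young diagrams and q-dimensions\<close>

text \<open>A Young diagram is the list of its nonzero row lengths.\<close>

definition young :: "nat list \<Rightarrow> bool" where
  "young la \<longleftrightarrow> sorted_wrt (\<ge>) la \<and> 0 \<notin> set la"

definition part :: "nat list \<Rightarrow> nat \<Rightarrow> nat" where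
  "part la i = (if i < length la then la ! i else 0)"

text \<open>The rows are counted from 0.\<close>

definition dimq_sl :: "complex \<Rightarrow> nat \<Rightarrow> nat list \<Rightarrow> complex" where
  "dimq_sl s N mu =
     (\<Prod>j<N. \<Prod>i<j.
        qnum s (of_nat (part mu i) - of_nat (part mu j) + of_nat j - of_nat i)
          / qnum s (of_nat j - of_nat i))"

text \<open>Weyl's formula for type C with k rows: the coordinates of \<open>\<lambda> + \<rho>\<close> are
  \<open>l i = part la i + k - i\<close>, and the positive roots are \<open>\<epsilon> i - \<epsilon> j\<close>,
  \<open>\<epsilon> i + \<epsilon> j\<close> for \<open>i < j\<close> and \<open>2 \<epsilon> i\<close>. The \<open>\<epsilon> i\<close> are orthonormal for the
  invariant form, so that the q-dimension of the vector representation is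
  \<open>[2k+1] - 1\<close>.\<close>

definition dimq_sp :: "complex \<Rightarrow> nat \<Rightarrow> nat list \<Rightarrow> complex" where
  "dimq_sp s k la =
     (let l = (\<lambda>i. of_nat (part la i) + of_nat k - of_nat i);
          r = (\<lambda>i. of_nat k - of_nat i)
      in (\<Prod>i<k. qnum s (2 * l i) / qnum s (2 * r i)) *
         (\<Prod>j<k. \<Prod>i<j. (qnum s (l i - l j) * qnum s (l i + l j))
                            / (qnum s (r i - r j) * qnum s (r i + r j))))"

section \<open>Algebras over the complex numbers, and their representations\<close>

locale complex_algebra = vector_space smul
  for smul :: "complex \<Rightarrow> 'a::ring_1 \<Rightarrow> 'a" +
  assumes scale_mult_left: "smul c x * y = smul c (x * y)"
    and scale_mult_right: "x * smul c y = smul c (x * y)"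

definition unital_subalgebra :: "(complex \<Rightarrow> 'a::ring_1 \<Rightarrow> 'a) \<Rightarrow> 'a set \<Rightarrow> bool" where
  "unital_subalgebra smul A \<longleftrightarrow>
     1 \<in> A \<and> (\<forall>x\<in>A. \<forall>y\<in>A. x + y \<in> A \<and> x * y \<in> A) \<and> (\<forall>c. \<forall>x\<in>A. smul c x \<in> A)"

definition algebra_gen :: "(complex \<Rightarrow> 'a::ring_1 \<Rightarrow> 'a) \<Rightarrow> 'a set \<Rightarrow> 'a set" where
  "algebra_gen smul S = \<Inter>{A. unital_subalgebra smul A \<and> S \<subseteq> A}"

definition matrix_rep ::
  "(complex \<Rightarrow> 'a::ring_1 \<Rightarrow> 'a) \<Rightarrow> 'a set \<Rightarrow> nat \<Rightarrow> ('a \<Rightarrow> complex mat) \<Rightarrow> bool" where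
  "matrix_rep smul A d f \<longleftrightarrow>
     (\<forall>x\<in>A. f x \<in> carrier_mat d d) \<and> f 1 = 1\<^sub>m d \<and>
     (\<forall>x\<in>A. \<forall>y\<in>A. f (x + y) = f x + f y \<and> f (x * y) = f x * f y) \<and>
     (\<forall>c. \<forall>x\<in>A. f (smul c x) = c \<cdot>\<^sub>m f x)"

definition minimal_idempotent ::
  "(complex \<Rightarrow> 'a::ring_1 \<Rightarrow> 'a) \<Rightarrow> 'a set \<Rightarrow> 'a \<Rightarrow> bool" where
  "minimal_idempotent smul A p \<longleftrightarrow>
     p \<in> A \<and> p \<noteq> 0 \<and> p * p = p \<and> (\<forall>x\<in>A. \<exists>c. p * x * p = smul c p)"

text \<open>A is semisimple, i.e. a direct sum of full matrix algebras, and \<open>rho l\<close>, of dimension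
  \<open>d l\<close>, for l in L are its pairwise nonisomorphic irreducible representations.\<close>

definition semisimple_decomposition ::
  "(complex \<Rightarrow> 'a::ring_1 \<Rightarrow> 'a) \<Rightarrow> 'a set \<Rightarrow> 'l set \<Rightarrow> ('l \<Rightarrow> nat) \<Rightarrow>
     ('l \<Rightarrow> 'a \<Rightarrow> complex mat) \<Rightarrow> bool" where
  "semisimple_decomposition smul A L d rho \<longleftrightarrow>
     finite L \<and> (\<forall>l\<in>L. 0 < d l \<and> matrix_rep smul A (d l) (rho l)) \<and>
     (\<forall>B. (\<forall>l\<in>L. B l \<in> carrier_mat (d l) (d l)) \<longrightarrow> (\<exists>!x. x \<in> A \<and> (\<forall>l\<in>L. rho l x = B l)))"

definition normalized_trace ::
  "(complex \<Rightarrow> 'a::ring_1 \<Rightarrow> 'a) \<Rightarrow> 'a set \<Rightarrow> ('a \<Rightarrow> complex) \<Rightarrow> bool" where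
  "normalized_trace smul A tr \<longleftrightarrow>
     tr 1 = 1 \<and> (\<forall>x\<in>A. \<forall>y\<in>A. tr (x + y) = tr x + tr y \<and> tr (x * y) = tr (y * x)) \<and>
     (\<forall>c. \<forall>x\<in>A. tr (smul c x) = c * tr x)"

section \<open>Tensor powers\<close>

text \<open>Let V have the basis \<open>v 0, \<dots>, v (N-1)\<close>. The standard basis of the n-th tensor power of V
  is indexed by the numbers below \<open>N^n\<close>: the number r stands for the tensor product of the
  \<open>v (digit N r i)\<close>, \<open>i = 0, \<dots>, n-1\<close>. Operators are given by their matrices.\<close>

definition digit :: "nat \<Rightarrow> nat \<Rightarrow> nat \<Rightarrow> nat" where
  "digit N r i = r div N ^ i mod N"

definition tensor_power :: "nat \<Rightarrow> nat \<Rightarrow> complex mat \<Rightarrow> complex mat" where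
  "tensor_power N n A =
     mat (N ^ n) (N ^ n) (\<lambda>(r, c). \<Prod>i<n. A $$ (digit N r i, digit N c i))"

definition End_tensor :: "nat \<Rightarrow> nat \<Rightarrow> complex mat set \<Rightarrow> complex mat set" where
  "End_tensor N n G =
     {A \<in> carrier_mat (N ^ n) (N ^ n). \<forall>h\<in>G. A * tensor_power N n h = tensor_power N n h * A}"

definition SL :: "nat \<Rightarrow> complex mat set" where
  "SL N = {h \<in> carrier_mat N N. det h = 1}"

text \<open>\<open>Sp(2k)\<close> inside \<open>SL(2k+1)\<close>: it fixes \<open>v k\<close>, which spans the trivial summand, and acts on
  the span V' of the other basis vectors, where it preserves the symplectic form that pairs
  \<open>v i\<close> with \<open>v (2k-i)\<close>.\<close>

definition symplectic_form :: "nat \<Rightarrow> complex mat" where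
  "symplectic_form k = mat (2*k+1) (2*k+1)
     (\<lambda>(i, j). if i + j = 2 * k \<and> i < k then 1 else if i + j = 2 * k \<and> k < i then - 1 else 0)"

definition Sp :: "nat \<Rightarrow> complex mat set" where
  "Sp k = {h \<in> carrier_mat (2*k+1) (2*k+1).
     (\<forall>i<2*k+1. h $$ (i, k) = (if i = k then 1 else 0) \<and> h $$ (k, i) = (if i = k then 1 else 0)) \<and>
     transpose_mat h * symplectic_form k * h = symplectic_form k}"

text \<open>Action of the i-th generator of the Hecke algebra on the n-th tensor power of V
  (\<open>1 \<le> i < n\<close>), which involves the tensor factors \<open>i-1\<close> and \<open>i\<close>. On these it maps
  \<open>v x \<otimes> v x\<close> to \<open>q v x \<otimes> v x\<close> and, for \<open>x \<noteq> y\<close>, \<open>v x \<otimes> v y\<close> to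
  \<open>v y \<otimes> v x\<close>, plus \<open>(q - 1/q) v x \<otimes> v y\<close> if \<open>x > y\<close>.\<close>

definition hecke_gen :: "complex \<Rightarrow> nat \<Rightarrow> nat \<Rightarrow> nat \<Rightarrow> complex mat" where
  "hecke_gen q N n i = mat (N ^ n) (N ^ n) (\<lambda>(r, c).
     let x = digit N c (i - 1); y = digit N c i; x' = digit N r (i - 1); y' = digit N r i
     in if (\<exists>j<n. j \<noteq> i - 1 \<and> j \<noteq> i \<and> digit N r j \<noteq> digit N c j) then 0
        else if x = y then (if x' = x \<and> y' = x then q else 0)
        else (if x' = y \<and> y' = x then 1 else 0)
             + (if x > y \<and> x' = x \<and> y' = y then q - 1 / q else 0))"

section \<open>Highest weights\<close>

text \<open>Weights of the standard basis vectors of the n-th tensor power of V for the diagonal torus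
  of \<open>SL(N)\<close> (or its q-analogue) and of \<open>Sp(2k)\<close>. In the latter case \<open>v i\<close> has weight
  \<open>\<epsilon> i\<close> for \<open>i < k\<close>, and \<open>v (2k-i)\<close> has weight \<open>- \<epsilon> i\<close>.\<close>

definition weight_sl :: "nat \<Rightarrow> nat \<Rightarrow> nat \<Rightarrow> nat \<Rightarrow> int" where
  "weight_sl N n r j = int (card {i. i < n \<and> digit N r i = j})"

definition weight_sp :: "nat \<Rightarrow> nat \<Rightarrow> nat \<Rightarrow> nat \<Rightarrow> int" where
  "weight_sp k n r j =
     int (card {i. i < n \<and> digit (2*k+1) r i = j})
     - int (card {i. i < n \<and> digit (2*k+1) r i = 2 * k - j})"

definition weight_vector ::
  "nat \<Rightarrow> (nat \<Rightarrow> nat \<Rightarrow> int) \<Rightarrow> complex vec \<Rightarrow> (nat \<Rightarrow> int) \<Rightarrow> bool" where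
  "weight_vector rk wt v nu \<longleftrightarrow>
     v \<noteq> 0\<^sub>v (dim_vec v) \<and> (\<forall>r<dim_vec v. v $ r \<noteq> 0 \<longrightarrow> (\<forall>j<rk. wt r j = nu j))"

text \<open>The diagram la is the highest weight of the image of p: it is a weight, and it dominates all
  the other weights.\<close>

definition highest_weight ::
  "nat \<Rightarrow> (nat \<Rightarrow> nat \<Rightarrow> int) \<Rightarrow> complex mat \<Rightarrow> nat list \<Rightarrow> bool" where
  "highest_weight rk wt p la \<longleftrightarrow> young la \<and> length la \<le> rk \<and>
     (let W = {p *\<^sub>v x | x. x \<in> carrier_vec (dim_col p)}
      in (\<exists>v\<in>W. weight_vector rk wt v (\<lambda>j. int (part la j))) \<and>
         (\<forall>v\<in>W. \<forall>nu. weight_vector rk wt v nu \<longrightarrow>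
            (\<forall>m\<le>rk. (\<Sum>j<m. nu j) \<le> (\<Sum>j<m. int (part la j)))))"

section \<open>The extensions of the Hecke algebras\<close>

text \<open>The algebras \<open>C n\<close> (\<open>n \<ge> 1\<close>) are subalgebras of one algebra, e.g. of their union. The
  subalgebra \<open>H n\<close> of \<open>C n\<close> generated by \<open>g 1, \<dots>, g (n-1)\<close> is identified with the image of
  the Hecke algebra on the n-th tensor power of V by the faithful representation
  \<open>sigma n\<close>. The isomorphism \<open>Phi n\<close> expresses that the inclusion of \<open>H n\<close> in \<open>C n\<close> has the
  structure of the inclusion of the endomorphisms commuting with \<open>SL(N)\<close> in those commuting
  with \<open>Sp(N-1)\<close>, and it also provides the labels of the minimal idempotents of \<open>C n\<close>.\<close>

locale sp_extension = complex_algebra smul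
  for smul :: "complex \<Rightarrow> 'a::ring_1 \<Rightarrow> 'a" +
  fixes k N :: nat and q :: complex
    and C :: "nat \<Rightarrow> 'a set" and g :: "nat \<Rightarrow> 'a" and e :: 'a
    and H :: "nat \<Rightarrow> 'a set"
    and sigma Phi :: "nat \<Rightarrow> 'a \<Rightarrow> complex mat"
  assumes N_eq: "N = 2 * k + 1"
    and subalgebra: "n \<ge> 1 \<Longrightarrow> unital_subalgebra smul (C n)"
    and C_mono: "n \<ge> 1 \<Longrightarrow> C n \<subseteq> C (Suc n)"
    and g_in: "1 \<le> i \<Longrightarrow> i < n \<Longrightarrow> g i \<in> C n"
    and H_eq: "n \<ge> 1 \<Longrightarrow> H n = algebra_gen smul (g ` {1..<n})"
    and sigma_rep: "n \<ge> 1 \<Longrightarrow> matrix_rep smul (H n) (N ^ n) (sigma n)"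
    and sigma_inj: "n \<ge> 1 \<Longrightarrow> inj_on (sigma n) (H n)"
    and sigma_g: "1 \<le> i \<Longrightarrow> i < n \<Longrightarrow> sigma n (g i) = hecke_gen q N n i"
    and Phi_rep: "n \<ge> 1 \<Longrightarrow> matrix_rep smul (C n) (N ^ n) (Phi n)"
    and Phi_C: "n \<ge> 1 \<Longrightarrow> bij_betw (Phi n) (C n) (End_tensor N n (Sp k))"
    and Phi_H: "n \<ge> 1 \<Longrightarrow> Phi n ` H n = End_tensor N n (SL N)"
    and Phi_label: "n \<ge> 1 \<Longrightarrow> minimal_idempotent smul (H n) p \<Longrightarrow>
      highest_weight N (weight_sl N n) (Phi n p) mu
        \<longleftrightarrow> highest_weight N (weight_sl N n) (sigma n p) mu"
    and e_in: "e \<in> C 1"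
    and Phi_e: "Phi 1 e = mat N N (\<lambda>(i, j). if i = k \<and> j = k then 1 else 0)"

definition H_label ::
  "(complex \<Rightarrow> 'a::ring_1 \<Rightarrow> 'a) \<Rightarrow> nat \<Rightarrow> (nat \<Rightarrow> 'a set) \<Rightarrow> (nat \<Rightarrow> 'a \<Rightarrow> complex mat) \<Rightarrow>
     nat \<Rightarrow> 'a \<Rightarrow> nat list \<Rightarrow> bool" where
  "H_label smul N H sigma n p mu \<longleftrightarrow>
     minimal_idempotent smul (H n) p \<and> highest_weight N (weight_sl N n) (sigma n p) mu"

definition C_label ::
  "(complex \<Rightarrow> 'a::ring_1 \<Rightarrow> 'a) \<Rightarrow> nat \<Rightarrow> (nat \<Rightarrow> 'a set) \<Rightarrow> (nat \<Rightarrow> 'a \<Rightarrow> complex mat) \<Rightarrow>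
     nat \<Rightarrow> 'a \<Rightarrow> nat list \<Rightarrow> bool" where
  "C_label smul k C Phi n p la \<longleftrightarrow>
     minimal_idempotent smul (C n) p \<and> highest_weight k (weight_sp k n) (Phi n p) la"

text \<open>The trace is one functional on the union of the \<open>C n\<close>, so it is compatible with the
  inclusions.\<close>

locale sp_extension_trace = sp_extension +
  fixes s :: complex and tr :: "'a \<Rightarrow> complex"
  assumes s_square: "s\<^sup>2 = q"
    and tr_trace: "n \<ge> 1 \<Longrightarrow> normalized_trace smul (C n) tr"
    and tr_H: "n \<ge> 1 \<Longrightarrow> H_label smul N H sigma n p mu \<Longrightarrow>
      tr p = dimq_sl s N mu / qnum s (of_nat N) ^ n"
    and tr_C: "n \<ge> 1 \<Longrightarrow> C_label smul k C Phi n p la \<Longrightarrow>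
      tr p = dimq_sp s k la / qnum s (of_nat N) ^ n"
    and tr_e: "tr e = 1 / qnum s (of_nat N)"

end

theory Submission
  imports Defs
begin

text \<open>The entries are determined by the Markov property for \<open>n = 1\<close> and \<open>x = e\<close>: as
  \<open>u 1 = q - g 1\<close>, it says that \<open>tr (e u 1) = tr e tr (u 1)\<close>, and both sides can be computed independently.

  On the right, \<open>tr e = 1/[N]\<close>. The element \<open>u 1 / [2]\<close> is a minimal idempotent of the Hecke
  algebra, and on the tensor square of V it projects onto the quantum exterior square, whose
  highest weight is the diagram \<open>[1, 1]\<close> (\<open>highest_weight_antisymmetrizer\<close>). The prescribed trace
  value and the q-dimension \<open>[N] [N-1] / [2]\<close> (\<open>dimq_sl_column_2\<close>) give \<open>tr (u 1) = [N-1]/[N]\<close>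
  (\<open>trace_u1\<close>).

  On the left, \<open>tr (e u 1) = tr (e u 1 e)\<close> sees only the upper left entries a and c of the two
  2-dimensional representations, weighted by the traces of minimal idempotents in these two blocks
  (\<open>trace_corner\<close>), so that it equals \<open>(a + ([N] - 1) c) / [N]^2\<close>.

  The result is the linear equation \<open>a + ([N] - 1) c = [N-1]\<close>. Together with \<open>a = c + 1\<close> or with
  \<open>a = c - 1\<close> it determines a and c, and factoring differences of squares brings the solution into
  the stated form (\<open>entries_of_trace_equation\<close>).\<close>

section \<open>q-numbers\<close>

lemma qpow_half_int: "x = of_int m / 2 \<Longrightarrow> qpow s x = s powi m"
proof -
  assume "x = of_int m / 2"
  then have "2 * x = of_int m" by simp
  then show ?thesis by (simp add: qpow_def)
qed

lemma qpow_of_nat: "qpow s (of_nat n) = (s\<^sup>2) ^ n"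
proof -
  have "qpow s (of_nat n) = s powi (int (2 * n))"
    by (rule qpow_half_int) simp
  then show ?thesis
    by (simp only: power_int_of_nat power_mult)
qed

lemma qpow_uminus: "x = of_int m / 2 \<Longrightarrow> qpow s (- x) = inverse (qpow s x)"
  using qpow_half_int[of x m s] qpow_half_int[of "- x" "- m" s]
  by (simp add: power_int_minus)

lemma qnum_of_nat:
  "qnum s (of_nat n) = ((s\<^sup>2) ^ n - inverse ((s\<^sup>2) ^ n)) / (s\<^sup>2 - inverse (s\<^sup>2))"
proof -
  have "qpow s (- of_nat m) = inverse ((s\<^sup>2) ^ m)" for m :: nat
    using qpow_uminus[of "of_nat m" "2 * int m" s] by (simp add: qpow_of_nat)
  from this[of n] this[of 1] show ?thesis
    using qpow_of_nat[of s n] qpow_of_nat[of s 1] by (simp add: qnum_def)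
qed

lemma power_neq_inverse_power:
  fixes q :: complex
  assumes q: "q \<noteq> 0" "\<forall>n\<ge>1. q ^ n \<noteq> 1" and n: "n \<ge> 1"
  shows "q ^ n - inverse (q ^ n) \<noteq> 0"
proof
  assume "q ^ n - inverse (q ^ n) = 0"
  then have "q ^ n * q ^ n = 1"
    using q(1) by (metis eq_iff_diff_eq_0 power_not_zero right_inverse)
  then have "q ^ (n + n) = 1"
    by (simp add: power_add)
  with q(2) n show False
    by (metis le_add1 order_trans)
qed

lemma qnum_of_nat_neq_0:
  assumes q: "s\<^sup>2 \<noteq> 0" "\<forall>n\<ge>1. (s\<^sup>2) ^ n \<noteq> 1" and n: "n \<ge> 1"
  shows "qnum s (of_nat n) \<noteq> 0"
  using power_neq_inverse_power[OF q n] power_neq_inverse_power[OF q, of 1]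
  by (simp add: qnum_of_nat)

lemma qnum_1:
  assumes "s\<^sup>2 \<noteq> 0" "\<forall>n\<ge>1. (s\<^sup>2) ^ n \<noteq> 1"
  shows "qnum s 1 = 1"
  using qnum_of_nat[of s 1] power_neq_inverse_power[OF assms, of 1] by simp

section \<open>The q-dimensions of the second exterior power and of the trivial module\<close>

text \<open>Induction on N: the new factors of the product, those with \<open>j = N\<close>, are 1 except for the
  first two rows, where they telescope to \<open>[N+1] / [N-1]\<close>.\<close>

lemma dimq_sl_column_2:
  assumes q: "s\<^sup>2 \<noteq> 0" "\<forall>n\<ge>1. (s\<^sup>2) ^ n \<noteq> 1" and N: "N \<ge> 2"
  shows "dimq_sl s N [1, 1] = qnum s (of_nat N) * qnum s (of_nat (N - 1)) / qnum s 2"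
  using N
proof (induction N rule: nat_induct_at_least)
  case base
  have "{..<2::nat} = {0, 1}" by auto
  then show ?case
    using qnum_1[OF q] qnum_of_nat_neq_0[OF q, of 2]
    by (simp add: dimq_sl_def part_def lessThan_Suc)
next
  case (Suc n)
  let ?f = "\<lambda>i. qnum s (of_nat (part [1, 1] i) - of_nat (part [1, 1] n) + of_nat n - of_nat i)
                 / qnum s (of_nat n - of_nat i)"
  have pn: "part [Suc 0, Suc 0] n = 0"
    using Suc.hyps by (simp add: part_def)
  have p01: "part [Suc 0, Suc 0] 0 = 1" "part [Suc 0, Suc 0] (Suc 0) = 1"
    by (simp_all add: part_def)
  have "{..<n} = insert 0 (insert 1 {2..<n})"
    using Suc.hyps by auto
  then have split: "(\<Prod>i<n. ?f i) = ?f 0 * (?f 1 * (\<Prod>i\<in>{2..<n}. ?f i))"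
    by simp
  have rest: "(\<Prod>i\<in>{2..<n}. ?f i) = 1"
  proof (rule prod.neutral, intro ballI)
    fix i assume i: "i \<in> {2..<n}"
    then have "qnum s (of_nat n - of_nat i) \<noteq> 0"
      using qnum_of_nat_neq_0[OF q, of "n - i"] by (auto simp: of_nat_diff Suc_le_eq)
    moreover have "part [Suc 0, Suc 0] i = 0"
      using i by (simp add: part_def)
    ultimately show "?f i = 1"
      using pn by simp
  qed
  have f0: "?f 0 = qnum s (of_nat (Suc n)) / qnum s (of_nat n)"
    by (simp add: pn p01)
  have f1: "?f 1 = qnum s (of_nat n) / qnum s (of_nat (n - 1))"
    using Suc.hyps by (simp add: pn p01 of_nat_diff)
  have "qnum s (of_nat n) \<noteq> 0"
    using qnum_of_nat_neq_0[OF q, of n] Suc.hyps by simp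
  then have "(\<Prod>i<n. ?f i) = qnum s (of_nat (Suc n)) / qnum s (of_nat (n - 1))"
    unfolding split rest f0 f1 by simp
  moreover have "dimq_sl s (Suc n) [1, 1] = dimq_sl s n [1, 1] * (\<Prod>i<n. ?f i)"
    by (simp add: dimq_sl_def)
  ultimately show ?case
    using Suc qnum_of_nat_neq_0[OF q, of "n - 1"] by simp
qed

lemma dimq_sp_empty:
  assumes q: "s\<^sup>2 \<noteq> 0" "\<forall>n\<ge>1. (s\<^sup>2) ^ n \<noteq> 1"
  shows "dimq_sp s k [] = 1"
proof -
  have *: "qnum s x \<noteq> 0" if "x = of_nat m" "m \<ge> 1" for x m
    using qnum_of_nat_neq_0[OF q] that by simp
  have double: "qnum s (2 * (of_nat k - of_nat i)) \<noteq> 0" if "i < k" for i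
    using that by (intro *[of _ "2 * (k - i)"]) (simp_all add: of_nat_diff)
  have diff: "qnum s (of_nat k - of_nat i - (of_nat k - of_nat j)) \<noteq> 0" if "i < j" for i j
    using that by (intro *[of _ "j - i"]) (simp_all add: of_nat_diff)
  have sum: "qnum s (of_nat k - of_nat i + (of_nat k - of_nat j)) \<noteq> 0" if "i < j" "j < k" for i j
    using that by (intro *[of _ "(k - i) + (k - j)"]) (simp_all add: of_nat_diff)
  have "(\<Prod>i<k. qnum s (2 * (of_nat k - of_nat i)) / qnum s (2 * (of_nat k - of_nat i))) = 1"
    using double by (intro prod.neutral) auto
  moreover have "(\<Prod>j<k. \<Prod>i<j.
      (qnum s (of_nat k - of_nat i - (of_nat k - of_nat j)) * qnum s (of_nat k - of_nat i + (of_nat k - of_nat j)))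
      / (qnum s (of_nat k - of_nat i - (of_nat k - of_nat j)) * qnum s (of_nat k - of_nat i + (of_nat k - of_nat j)))) = 1"
    using diff sum by (intro prod.neutral ballI divide_self) auto
  ultimately show ?thesis
    by (simp only: dimq_sp_def part_def Let_def list.size not_less_zero if_False of_nat_0 add_0 mult_1_right)
qed

section \<open>Minimal idempotents of algebras over the complex numbers\<close>

lemma unital_subalgebra_algebra_gen: "unital_subalgebra smul (algebra_gen smul S)"
  unfolding algebra_gen_def unital_subalgebra_def by blast

lemma algebra_gen_superset: "S \<subseteq> algebra_gen smul S"
  unfolding algebra_gen_def by blast

lemma algebra_gen_least:
  "unital_subalgebra smul A \<Longrightarrow> S \<subseteq> A \<Longrightarrow> algebra_gen smul S \<subseteq> A"
  unfolding algebra_gen_def by blast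

lemma unital_subalgebra_closed:
  assumes "unital_subalgebra smul A"
  shows "1 \<in> A" "x \<in> A \<Longrightarrow> y \<in> A \<Longrightarrow> x + y \<in> A" "x \<in> A \<Longrightarrow> y \<in> A \<Longrightarrow> x * y \<in> A"
    "x \<in> A \<Longrightarrow> smul t x \<in> A"
  using assms unfolding unital_subalgebra_def by blast+

lemma matrix_rep_simps:
  assumes "matrix_rep smul A d f"
  shows "x \<in> A \<Longrightarrow> f x \<in> carrier_mat d d" "f 1 = 1\<^sub>m d"
    "x \<in> A \<Longrightarrow> y \<in> A \<Longrightarrow> f (x + y) = f x + f y"
    "x \<in> A \<Longrightarrow> y \<in> A \<Longrightarrow> f (x * y) = f x * f y"
    "x \<in> A \<Longrightarrow> f (smul t x) = t \<cdot>\<^sub>m f x"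
  using assms unfolding matrix_rep_def by metis+

lemma normalized_trace_simps:
  assumes "normalized_trace smul A tr"
  shows "tr 1 = 1" "x \<in> A \<Longrightarrow> y \<in> A \<Longrightarrow> tr (x + y) = tr x + tr y"
    "x \<in> A \<Longrightarrow> y \<in> A \<Longrightarrow> tr (x * y) = tr (y * x)" "x \<in> A \<Longrightarrow> tr (smul t x) = t * tr x"
  using assms unfolding normalized_trace_def by metis+

lemma semisimple_decomposition_blocks:
  assumes "semisimple_decomposition smul A L d rho" "l \<in> L"
  shows "matrix_rep smul A (d l) (rho l)" "0 < d l"
  using assms by (auto simp: semisimple_decomposition_def)

lemma semisimple_decomposition_ex1:
  assumes "semisimple_decomposition smul A L d rho"
    and "\<And>l. l \<in> L \<Longrightarrow> B l \<in> carrier_mat (d l) (d l)"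
  shows "\<exists>!x. x \<in> A \<and> (\<forall>l\<in>L. rho l x = B l)"
proof -
  have "\<forall>B. (\<forall>l\<in>L. B l \<in> carrier_mat (d l) (d l)) \<longrightarrow> (\<exists>!x. x \<in> A \<and> (\<forall>l\<in>L. rho l x = B l))"
    using assms(1) unfolding semisimple_decomposition_def by (elim conjE)
  from spec[OF this, of B] assms(2) show ?thesis by blast
qed

context complex_algebra
begin

lemma minus_eq_scale: "x - y = x + smul (- 1) y"
  by (simp add: scale_minus_left)

lemma trace_diff:
  assumes A: "unital_subalgebra smul A" and tr: "normalized_trace smul A tr"
    and xy: "x \<in> A" "y \<in> A"
  shows "tr (x - y) = tr x - tr y"
proof -
  have "smul (- 1) y \<in> A"
    using unital_subalgebra_closed(4)[OF A] xy by blast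
  then have "tr (x - y) = tr x + tr (smul (- 1) y)"
    unfolding minus_eq_scale[of x y] using normalized_trace_simps(2)[OF tr] xy by blast
  then show ?thesis
    unfolding normalized_trace_simps(4)[OF tr xy(2)] by simp
qed

lemma matrix_rep_0:
  assumes "unital_subalgebra smul A" "matrix_rep smul A d f"
  shows "f 0 = 0\<^sub>m d d"
proof -
  have "f (smul 0 1) = 0 \<cdot>\<^sub>m f 1"
    by (rule matrix_rep_simps(5)[OF assms(2) unital_subalgebra_closed(1)[OF assms(1)]])
  then show ?thesis
    using matrix_rep_simps(2)[OF assms(2)] by auto
qed

text \<open>The elements that p absorbs up to a scalar under right multiplication form a subalgebra. As it
  contains the generator, it is everything.\<close>

lemma minimal_idempotent_algebra_gen_singleton:
  assumes p: "p \<in> algebra_gen smul {h}" "p \<noteq> 0" "p * p = p"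
    and eigen: "p * h = smul \<kappa> p"
  shows "minimal_idempotent smul (algebra_gen smul {h}) p"
proof -
  let ?A = "{x. \<exists>t. p * x = smul t p}"
  have "unital_subalgebra smul ?A"
    unfolding unital_subalgebra_def
  proof (intro conjI ballI allI)
    have "p * 1 = smul 1 p" by simp
    then show "1 \<in> ?A" by blast
  next
    fix x y assume "x \<in> ?A" "y \<in> ?A"
    then obtain t t' where t: "p * x = smul t p" "p * y = smul t' p" by blast
    have "p * (x + y) = smul (t + t') p"
      by (simp add: distrib_left t scale_left_distrib)
    then show "x + y \<in> ?A" by blast
    have "p * (x * y) = smul (t * t') p"
      by (simp add: mult.assoc[symmetric] t scale_mult_left)
    then show "x * y \<in> ?A" by blast
  next
    fix r x assume "x \<in> ?A"
    then obtain t where t: "p * x = smul t p" by blast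
    have "p * smul r x = smul (r * t) p"
      by (simp add: scale_mult_right t)
    then show "smul r x \<in> ?A" by blast
  qed
  moreover have "{h} \<subseteq> ?A"
    using eigen by blast
  ultimately have gen: "algebra_gen smul {h} \<subseteq> ?A"
    by (rule algebra_gen_least)
  show ?thesis
    unfolding minimal_idempotent_def
  proof (intro conjI ballI)
    fix x assume "x \<in> algebra_gen smul {h}"
    then obtain t where "p * x = smul t p"
      using gen by blast
    then have "p * x * p = smul t p"
      by (simp add: scale_mult_left p)
    then show "\<exists>t. p * x * p = smul t p" by blast
  qed (use p in auto)
qed

lemma semisimple_eqI:
  assumes dec: "semisimple_decomposition smul A L d rho" and xy: "x \<in> A" "y \<in> A"
    and eq: "\<And>l. l \<in> L \<Longrightarrow> rho l x = rho l y"
  shows "x = y"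
proof -
  have "\<exists>!z. z \<in> A \<and> (\<forall>l\<in>L. rho l z = rho l y)"
    using semisimple_decomposition_blocks[OF dec] matrix_rep_simps(1) xy
    by (intro semisimple_decomposition_ex1[OF dec]) blast
  then obtain z where z: "\<forall>w. w \<in> A \<and> (\<forall>l\<in>L. rho l w = rho l y) \<longrightarrow> w = z"
    by (elim ex1E)
  have "x = z" "y = z"
    using xy eq by (intro z[rule_format]; simp)+
  then show ?thesis by simp
qed

end

definition matrix_unit_00 :: "nat \<Rightarrow> complex mat" where
  "matrix_unit_00 d = mat d d (\<lambda>(i, j). if i = 0 \<and> j = 0 then 1 else 0)"

lemma matrix_unit_00_carrier: "matrix_unit_00 d \<in> carrier_mat d d"
  by (simp add: matrix_unit_00_def)

lemma matrix_unit_00_sandwich: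
  assumes B: "B \<in> carrier_mat d d" and d: "0 < d"
  shows "matrix_unit_00 d * B * matrix_unit_00 d = B $$ (0, 0) \<cdot>\<^sub>m matrix_unit_00 d"
proof (rule eq_matI)
  fix i j assume ij: "i < dim_row (B $$ (0, 0) \<cdot>\<^sub>m matrix_unit_00 d)"
    "j < dim_col (B $$ (0, 0) \<cdot>\<^sub>m matrix_unit_00 d)"
  then have "(matrix_unit_00 d * B) $$ (i, m) = (if i = 0 then B $$ (0, m) else 0)"
    if "m < d" for m
    using B d that
    by (simp add: matrix_unit_00_def scalar_prod_def if_distrib[of "\<lambda>x. x * _"] cong: if_cong)
  then show "(matrix_unit_00 d * B * matrix_unit_00 d) $$ (i, j)
      = (B $$ (0, 0) \<cdot>\<^sub>m matrix_unit_00 d) $$ (i, j)"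
    using B d ij
    by (simp add: matrix_unit_00_def scalar_prod_def if_distrib[of "\<lambda>x. _ * x"] cong: if_cong)
qed (use B in \<open>auto simp: matrix_unit_00_def\<close>)

lemma matrix_unit_00_idem: "0 < d \<Longrightarrow> matrix_unit_00 d * matrix_unit_00 d = matrix_unit_00 d"
  using matrix_unit_00_sandwich[of "1\<^sub>m d" d]
  by (simp add: right_mult_one_mat[OF matrix_unit_00_carrier]) (auto simp: matrix_unit_00_def)

text \<open>Since the representations jointly identify A with a product of matrix algebras, the element
  that is a diagonal matrix unit in one block and zero in the others exists, and its minimality can
  be checked block by block.\<close>

lemma (in complex_algebra) minimal_idempotent_of_block:
  assumes dec: "semisimple_decomposition smul A L d rho" and A: "unital_subalgebra smul A"
    and l: "l \<in> L"
  obtains p where "minimal_idempotent smul A p" "rho l p = matrix_unit_00 (d l)"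
    "\<And>l'. l' \<in> L \<Longrightarrow> l' \<noteq> l \<Longrightarrow> rho l' p = 0\<^sub>m (d l') (d l')"
proof -
  note closed = unital_subalgebra_closed[OF A]
  note rep = semisimple_decomposition_blocks[OF dec]
  note rsimps = matrix_rep_simps[OF rep(1)]
  let ?B = "\<lambda>l'. if l' = l then matrix_unit_00 (d l) else 0\<^sub>m (d l') (d l')"
  have "\<exists>!p. p \<in> A \<and> (\<forall>l'\<in>L. rho l' p = ?B l')"
    by (rule semisimple_decomposition_ex1[OF dec]) (simp add: matrix_unit_00_carrier)
  then obtain p where "p \<in> A \<and> (\<forall>l'\<in>L. rho l' p = ?B l')"
    by (elim ex1E)
  then have p: "p \<in> A" "\<And>l'. l' \<in> L \<Longrightarrow> rho l' p = ?B l'"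
    by (blast, simp)
  have "p \<noteq> 0"
  proof
    assume "p = 0"
    then have "matrix_unit_00 (d l) = 0\<^sub>m (d l) (d l)"
      using p(2)[OF l] matrix_rep_0[OF A rep(1)[OF l]] by simp
    then have "matrix_unit_00 (d l) $$ (0, 0) = 0"
      using rep(2)[OF l] by simp
    then show False
      using rep(2)[OF l] by (simp add: matrix_unit_00_def)
  qed
  moreover have "p * p = p"
  proof (rule semisimple_eqI[OF dec])
    fix l' assume l': "l' \<in> L"
    show "rho l' (p * p) = rho l' p"
      using p l' rsimps(4)[OF l' p(1) p(1)] matrix_unit_00_idem[OF rep(2)[OF l]] by simp
  qed (use p closed in auto)
  moreover have "\<exists>t. p * x * p = smul t p" if x: "x \<in> A" for x
  proof
    show "p * x * p = smul (rho l x $$ (0, 0)) p"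
    proof (rule semisimple_eqI[OF dec])
      fix l' assume l': "l' \<in> L"
      have "rho l' (p * x * p) = ?B l' * rho l' x * ?B l'"
        using p l' x closed rsimps(4)[OF l'] by simp
      also have "\<dots> = rho l x $$ (0, 0) \<cdot>\<^sub>m ?B l'"
        using matrix_unit_00_sandwich[OF rsimps(1)[OF l x] rep(2)[OF l]] rsimps(1)[OF l' x]
        by auto
      finally show "rho l' (p * x * p) = rho l' (smul (rho l x $$ (0, 0)) p)"
        using p l' rsimps(5)[OF l'] by simp
    qed (use p x closed in auto)
  qed
  ultimately have "minimal_idempotent smul A p"
    using p(1) unfolding minimal_idempotent_def by blast
  with p(2) l show thesis
    by (intro that[of p]) auto
qed

section \<open>The Hecke generator on the tensor square\<close>

text \<open>The flip of the two tensor factors, on the indices of the basis of the tensor square.\<close>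

definition swap_digits :: "nat \<Rightarrow> nat \<Rightarrow> nat" where
  "swap_digits N r = digit N r 1 + N * digit N r 0"

lemma digit_lt: "N > 0 \<Longrightarrow> digit N r i < N"
  by (simp add: digit_def)

lemma eq_digits: "r < N ^ 2 \<Longrightarrow> r = digit N r 0 + N * digit N r 1"
  by (simp add: digit_def power2_eq_square less_mult_imp_div_less)

lemma digits_of_pair:
  assumes "x < N" "y < N"
  shows "digit N (x + N * y) 0 = x" "digit N (x + N * y) 1 = y" "x + N * y < N ^ 2"
proof -
  show "digit N (x + N * y) 0 = x" "digit N (x + N * y) 1 = y"
    using assms by (auto simp: digit_def)
  have "x + N * y < N * Suc y" using assms by simp
  also have "\<dots> \<le> N * N" using assms by (intro mult_le_mono2) simp
  finally show "x + N * y < N ^ 2" by (simp add: power2_eq_square)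
qed

lemma digits_swap:
  assumes "N > 0"
  shows "digit N (swap_digits N r) 0 = digit N r 1" "digit N (swap_digits N r) 1 = digit N r 0"
    "swap_digits N r < N ^ 2"
  using digits_of_pair[OF digit_lt[OF assms] digit_lt[OF assms]] by (simp_all add: swap_digits_def)

lemma eq_iff_digits:
  "r < N ^ 2 \<Longrightarrow> c < N ^ 2 \<Longrightarrow> r = c \<longleftrightarrow> digit N r 0 = digit N c 0 \<and> digit N r 1 = digit N c 1"
  using eq_digits[of r N] eq_digits[of c N] by auto

text \<open>The diagonal part and the flip part are separated, so that matrix products can be summed term
  by term. For \<open>x = y\<close> the index is fixed by the flip; the entry is then counted on the diagonal
  only.\<close>

lemma hecke_gen_entry:
  assumes rc: "r < N ^ 2" "c < N ^ 2"
  defines "x \<equiv> digit N c 0" and "y \<equiv> digit N c 1"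
  shows "hecke_gen q N 2 1 $$ (r, c) =
    (if r = c then (if x = y then q else if x > y then q - 1 / q else 0) else 0)
    + (if r = swap_digits N c then (if x = y then 0 else 1) else 0)"
proof -
  have N: "N > 0" using rc by (cases N) auto
  define x' y' where "x' = digit N r 0" and "y' = digit N r 1"
  have no_other: "(\<exists>j<2. 0 < j \<and> j \<noteq> Suc 0 \<and> P j) = False" for P :: "nat \<Rightarrow> bool"
    by auto
  have "hecke_gen q N 2 1 $$ (r, c) =
    (if x = y then (if x' = x \<and> y' = x then q else 0)
     else (if x' = y \<and> y' = x then 1 else 0)
          + (if x > y \<and> x' = x \<and> y' = y then q - 1 / q else 0))"
    using rc by (simp add: hecke_gen_def Let_def no_other x_def y_def x'_def y'_def)
  moreover have "r = c \<longleftrightarrow> x' = x \<and> y' = y"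
    unfolding eq_iff_digits[OF rc] x_def y_def x'_def y'_def by simp
  moreover have "r = swap_digits N c \<longleftrightarrow> x' = y \<and> y' = x"
    unfolding eq_iff_digits[OF rc(1) digits_swap(3)[OF N]] digits_swap(1,2)[OF N]
      x_def y_def x'_def y'_def by simp
  ultimately show ?thesis
    by (simp only:) auto
qed

lemma hecke_gen_carrier: "hecke_gen q N n i \<in> carrier_mat (N ^ n) (N ^ n)"
  by (simp add: hecke_gen_def)

text \<open>A column has nonzero entries only at its own index and at the flipped index, so each entry of
  the square is a sum of two terms.\<close>

lemma hecke_gen_quadratic:
  assumes q: "q \<noteq> 0"
  shows "hecke_gen q N 2 1 * hecke_gen q N 2 1
    = (q - 1 / q) \<cdot>\<^sub>m hecke_gen q N 2 1 + 1\<^sub>m (N ^ 2)" (is "?G * ?G = ?R")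
proof (rule eq_matI)
  fix r c assume "r < dim_row ?R" "c < dim_col ?R"
  then have rc: "r < N ^ 2" "c < N ^ 2"
    using hecke_gen_carrier[of q N 2 1] by auto
  then have N: "N > 0" by (cases N) auto
  define x y where "x = digit N c 0" and "y = digit N c 1"
  define \<alpha> where "\<alpha> = (if x = y then q else if x > y then q - 1 / q else 0)"
  define \<beta> where "\<beta> = (if x = y then 0 else (1::complex))"
  let ?c = "swap_digits N c"
  have sw: "?c < N ^ 2" "digit N ?c 0 = y" "digit N ?c 1 = x"
    using digits_swap[OF N] by (simp_all add: x_def y_def)
  have swsw: "swap_digits N ?c = c"
    using eq_digits[OF rc(2)] sw by (simp add: swap_digits_def x_def y_def)
  have col: "?G $$ (t, c) = (if t = c then \<alpha> else 0) + (if t = ?c then \<beta> else 0)"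
    if "t < N ^ 2" for t
    using hecke_gen_entry[OF that rc(2), of q] by (simp add: \<alpha>_def \<beta>_def x_def y_def)
  have "(?G * ?G) $$ (r, c) = (\<Sum>t<N ^ 2. ?G $$ (r, t) * ?G $$ (t, c))"
    using rc hecke_gen_carrier[of q N 2 1] by (simp add: scalar_prod_def atLeast0LessThan)
  also have "\<dots> = (\<Sum>t<N ^ 2. (if t = c then ?G $$ (r, t) * \<alpha> else 0)
      + (if t = ?c then ?G $$ (r, t) * \<beta> else 0))"
    by (intro sum.cong refl) (simp only: lessThan_iff col distrib_left, simp)
  also have "\<dots> = ?G $$ (r, c) * \<alpha> + ?G $$ (r, ?c) * \<beta>"
    using rc sw by (simp add: sum.distrib)
  also have "\<dots> = (q - 1 / q) * ?G $$ (r, c) + (if r = c then 1 else 0)"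
    using hecke_gen_entry[OF rc, of q] hecke_gen_entry[OF rc(1) sw(1), of q] q
    unfolding sw swsw \<alpha>_def \<beta>_def x_def[symmetric] y_def[symmetric]
    by (auto simp: field_simps)
  also have "\<dots> = ?R $$ (r, c)"
    using rc hecke_gen_carrier[of q N 2 1] by simp
  finally show "(?G * ?G) $$ (r, c) = ?R $$ (r, c)" .
qed (use hecke_gen_carrier[of q N 2 1] in auto)

lemma sum_weight_sl_2:
  assumes "r < N ^ 2"
  shows "(\<Sum>j<m. weight_sl N 2 r j) = (if digit N r 0 < m then 1 else 0) + (if digit N r 1 < m then 1 else 0)"
proof -
  have "{i. i < 2 \<and> P i} = (if P 0 then {0} else {}) \<union> (if P 1 then {1} else {})"
    for P :: "nat \<Rightarrow> bool"
    by (cases "P 0"; cases "P 1") (auto simp: less_2_cases_iff intro!: gr0I)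
  then have "weight_sl N 2 r j = (if digit N r 0 = j then 1 else 0) + (if digit N r 1 = j then 1 else 0)" for j
    by (simp add: weight_sl_def)
  then show ?thesis
    by (simp add: sum.distrib)
qed

text \<open>The rows of this matrix at the vectors \<open>v x \<otimes> v x\<close> vanish, so every weight of its image comes
  from two different digits, and such weights are dominated by \<open>[1, 1]\<close>. That weight occurs, namely
  for the image of \<open>v 0 \<otimes> v 1\<close>.\<close>

lemma highest_weight_antisymmetrizer:
  assumes q: "q \<noteq> 0" and N: "N \<ge> 2" and t: "t \<noteq> 0"
  shows "highest_weight N (weight_sl N 2)
    (t \<cdot>\<^sub>m (q \<cdot>\<^sub>m 1\<^sub>m (N ^ 2) + (- 1) \<cdot>\<^sub>m hecke_gen q N 2 1)) [1, 1]"
proof -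
  define M where "M = t \<cdot>\<^sub>m (q \<cdot>\<^sub>m 1\<^sub>m (N ^ 2) + (- 1) \<cdot>\<^sub>m hecke_gen q N 2 1)"
  have M: "M \<in> carrier_mat (N ^ 2) (N ^ 2)"
    using hecke_gen_carrier[of q N 2 1] by (simp add: M_def)
  note gen = hecke_gen_entry[unfolded One_nat_def]
  have N0: "N > 0" using N by simp
  have entry: "M $$ (r, c) = t * ((if r = c then q else 0) - hecke_gen q N 2 1 $$ (r, c))"
    if "r < N ^ 2" "c < N ^ 2" for r c
    using that hecke_gen_carrier[of q N 2 1] by (simp add: M_def)
  have diag: "M $$ (r, c) = 0" if "r < N ^ 2" "c < N ^ 2" "digit N r 0 = digit N r 1" for r c
  proof -
    have "digit N c 0 = digit N c 1" if "r = swap_digits N c"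
      using that \<open>digit N r 0 = digit N r 1\<close> digits_swap[OF N0, of c] by simp
    then show ?thesis
      using that by (auto simp: entry gen)
  qed
  \<comment> \<open>The index of \<open>v 0 \<otimes> v 1\<close> is \<open>0 + N * 1\<close>.\<close>
  let ?v = "M *\<^sub>v unit_vec (N ^ 2) N"
  have NN: "N < N ^ 2" using N by (simp add: power2_eq_square)
  have dN: "digit N N 0 = 0" "digit N N (Suc 0) = 1"
    using digits_of_pair[of 0 N 1] N by auto
  have v: "?v $ r = M $$ (r, N)" if "r < N ^ 2" for r
    using M NN that by (simp add: scalar_prod_right_unit)
  have "?v $ N \<noteq> 0"
    using NN dN q t N by (simp add: v entry gen swap_digits_def)
  then have "?v \<noteq> 0\<^sub>v (N ^ 2)"
    using NN by (metis index_zero_vec(1))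
  moreover have "weight_sl N 2 r j = int (part [1, 1] j)" if "r < N ^ 2" "?v $ r \<noteq> 0" for r j
  proof -
    have "r = N \<or> r = swap_digits N N"
      using that NN by (auto simp: v entry gen split: if_splits)
    then have d: "digit N r 0 = 0 \<and> digit N r 1 = 1 \<or> digit N r 0 = 1 \<and> digit N r 1 = 0"
      using dN digits_swap[OF N0, of N] by auto
    \<comment> \<open>The partial sums of the weights are known, hence so are their differences.\<close>
    have "weight_sl N 2 r j = (\<Sum>j<Suc j. weight_sl N 2 r j) - (\<Sum>j<j. weight_sl N 2 r j)"
      by simp
    also have "\<dots> = int (part [1, 1] j)"
      using d unfolding sum_weight_sl_2[OF that(1)] by (auto simp: part_def nth_Cons')
    finally show ?thesis .
  qed
  ultimately have wv: "weight_vector N (weight_sl N 2) ?v (\<lambda>j. int (part [1, 1] j))"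
    using NN M unfolding weight_vector_def by auto
  have dom: "(\<Sum>j<m. nu j) \<le> (\<Sum>j<m. int (part [1, 1] j))"
    if nu: "weight_vector N (weight_sl N 2) (M *\<^sub>v x) nu" and x: "x \<in> carrier_vec (N ^ 2)"
      and m: "m \<le> N" for x nu m
  proof -
    obtain r where r: "r < N ^ 2" "(M *\<^sub>v x) $ r \<noteq> 0"
      using nu M unfolding weight_vector_def by (metis carrier_matD(1) dim_mult_mat_vec eq_vecI index_zero_vec)
    have ne: "digit N r 0 \<noteq> digit N r 1"
    proof
      assume "digit N r 0 = digit N r 1"
      then have "(M *\<^sub>v x) $ r = 0"
        using r M x diag[OF r(1)] by (simp add: scalar_prod_def)
      with r show False by simp
    qed
    have "(\<Sum>j<m. nu j) = (\<Sum>j<m. weight_sl N 2 r j)"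
      using nu r M m unfolding weight_vector_def by (intro sum.cong) auto
    also have "\<dots> \<le> (if m = 0 then 0 else if m = 1 then 1 else 2)"
      unfolding sum_weight_sl_2[OF r(1)] using ne by auto
    also have "\<dots> = (\<Sum>j<m. int (part [1, 1] j))"
    proof (induction m)
      case (Suc m)
      then show ?case by (auto simp: part_def nth_Cons' split: if_splits)
    qed simp
    finally show ?thesis .
  qed
  have "highest_weight N (weight_sl N 2) M [1, 1]"
    unfolding highest_weight_def Let_def
  proof (intro conjI ballI allI impI)
    show "\<exists>v\<in>{M *\<^sub>v x |x. x \<in> carrier_vec (dim_col M)}.
        weight_vector N (weight_sl N 2) v (\<lambda>j. int (part [1, 1] j))"
      using wv M by (intro bexI[of _ ?v]) auto
  qed (use M N dom in \<open>auto simp: young_def\<close>)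
  then show ?thesis
    by (simp add: M_def)
qed

section \<open>Values of the Markov trace\<close>

text \<open>The quadratic relation is checked on the tensor square, where it lifts to the algebra because
  \<open>sigma 2\<close> is faithful. It yields \<open>u g = - u / q\<close> and \<open>u u = [2] u\<close> for \<open>u = u 1\<close>, hence \<open>u / [2]\<close>
  is a minimal idempotent.\<close>

lemma (in sp_extension_trace) trace_u1:
  assumes k: "k \<ge> 1" and q: "q \<noteq> 0" "\<forall>n\<ge>1. q ^ n \<noteq> 1"
  shows "tr (smul q 1 - g 1) = qnum s (of_nat (N - 1)) / qnum s (of_nat N)"
proof -
  have qs: "s\<^sup>2 \<noteq> 0" "\<forall>n\<ge>1. (s\<^sup>2) ^ n \<noteq> 1"
    using q s_square by auto
  have N: "N \<ge> 2" using k N_eq by simp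
  define u where "u = smul q 1 - g 1"
  define two where "two = q + 1 / q"
  have two: "two = qnum s 2" "two \<noteq> 0"
  proof -
    have "q\<^sup>2 - inverse (q\<^sup>2) = two * (q - inverse q)"
      using q(1) by (simp add: two_def power2_eq_square field_simps)
    then show "two = qnum s 2"
      using qnum_of_nat[of s 2] power_neq_inverse_power[OF q, of 1] s_square by simp
    then show "two \<noteq> 0"
      using qnum_of_nat_neq_0[OF qs, of 2] by simp
  qed
  have "{1..<2::nat} = {1}" by auto
  then have H2: "H 2 = algebra_gen smul {g 1}"
    using H_eq[of 2] by simp
  have sub: "unital_subalgebra smul (H 2)"
    unfolding H2 by (rule unital_subalgebra_algebra_gen)
  note closed = unital_subalgebra_closed[OF sub]
  have g: "g 1 \<in> H 2"
    unfolding H2 using algebra_gen_superset by blast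
  have rep: "matrix_rep smul (H 2) (N ^ 2) (sigma 2)"
    by (rule sigma_rep) simp
  note rsimps = matrix_rep_simps[OF rep]
  have sg: "sigma 2 (g 1) = hecke_gen q N 2 1"
    by (rule sigma_g) auto
  have "sigma 2 (g 1 * g 1) = sigma 2 (smul (q - 1 / q) (g 1) + 1)"
    using g closed
    by (simp add: rsimps sg[unfolded One_nat_def] hecke_gen_quadratic[OF q(1), unfolded One_nat_def])
  then have gg: "g 1 * g 1 = smul (q - 1 / q) (g 1) + 1"
    using sigma_inj[of 2] g closed by (simp add: inj_on_def)
  have ug: "u * g 1 = smul (- 1 / q) u"
    using q(1) by (simp add: u_def left_diff_distrib scale_mult_left gg[unfolded One_nat_def] scale_right_diff_distrib
        scale_left_diff_distrib)
  have uu: "u * u = smul two u"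
  proof -
    have "u * u = smul q u - u * g 1"
      by (simp add: u_def right_diff_distrib scale_mult_right)
    then show ?thesis
      by (simp add: ug[unfolded One_nat_def] two_def scale_left_distrib)
  qed
  have u_eq: "u = smul q 1 + smul (- 1) (g 1)"
    unfolding u_def by (rule minus_eq_scale)
  have uH: "u \<in> H 2"
    unfolding u_eq using g closed by blast
  define p where "p = smul (1 / two) u"
  have pH: "p \<in> H 2"
    unfolding p_def using uH closed by blast
  have sp: "sigma 2 p = (1 / two) \<cdot>\<^sub>m (q \<cdot>\<^sub>m 1\<^sub>m (N ^ 2) + (- 1) \<cdot>\<^sub>m hecke_gen q N 2 1)"
  proof -
    have "sigma 2 u = sigma 2 (smul q 1) + sigma 2 (smul (- 1) (g 1))"
      unfolding u_eq by (rule rsimps(3)) (use g closed in blast)+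
    then show ?thesis
      unfolding p_def rsimps(5)[OF uH]
      by (simp only: rsimps(5)[OF closed(1)] rsimps(5)[OF g] rsimps(2) sg)
  qed
  have hw: "highest_weight N (weight_sl N 2) (sigma 2 p) [1, 1]"
    unfolding sp using two by (intro highest_weight_antisymmetrizer[OF q(1) N]) simp
  have "p \<noteq> 0"
  proof
    assume "p = 0"
    then have "sigma 2 p = 0\<^sub>m (N ^ 2) (N ^ 2)"
      using matrix_rep_0[OF sub rep] by simp
    then show False
      using hw unfolding highest_weight_def Let_def weight_vector_def by auto
  qed
  moreover have "p * p = p"
    using two by (simp add: p_def scale_mult_left scale_mult_right uu)
  moreover have "p * g 1 = smul (- 1 / q) p"
    by (simp add: p_def scale_mult_left ug[unfolded One_nat_def] mult.commute)
  ultimately have "minimal_idempotent smul (H 2) p"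
    using pH unfolding H2 by (intro minimal_idempotent_algebra_gen_singleton)
  then have "H_label smul N H sigma 2 p [1, 1]"
    using hw by (simp add: H_label_def)
  then have trp: "tr p = dimq_sl s N [1, 1] / qnum s (of_nat N) ^ 2"
    by (rule tr_H[rotated]) simp
  have pC: "p \<in> C 2"
  proof -
    have "H 2 \<subseteq> C 2"
      unfolding H2 using g_in[of 1 2] subalgebra[of 2] by (intro algebra_gen_least) auto
    with pH show ?thesis by blast
  qed
  have "u = smul two p"
    using two by (simp add: p_def)
  then have "tr u = two * tr p"
    using normalized_trace_simps(4)[OF tr_trace[of 2] pC] by simp
  also have "\<dots> = qnum s (of_nat (N - 1)) / qnum s (of_nat N)"
    unfolding trp dimq_sl_column_2[OF qs N] two(1)[symmetric]
    using two(2) qnum_of_nat_neq_0[OF qs, of N] N by (simp add: power2_eq_square)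
  finally show ?thesis
    unfolding u_def .
qed

text \<open>On the sum of the blocks labeled by the trivial representation and by V' the element e is
  a rank one projection in each summand, and elsewhere it vanishes. So \<open>e x e\<close> is a combination of
  the two rank one projections, with the corner entries of x as coefficients, and the trace of
  \<open>e x\<close> is known once the traces of the two projections are. The first is given by the label. The
  second follows from it, as the two add up to the trace of e.\<close>

lemma (in sp_extension_trace) trace_corner:
  assumes q: "q \<noteq> 0" "\<forall>n\<ge>1. q ^ n \<noteq> 1"
    and L: "[] \<in> L" "[1] \<in> L"
    and C2: "semisimple_decomposition smul (C 2) L dm rho"
    and label: "\<And>p. minimal_idempotent smul (C 2) p \<Longrightarrow> rho [] p \<noteq> 0\<^sub>m (dm []) (dm []) \<Longrightarrow>
      C_label smul k C Phi 2 p []"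
    and e_blocks: "rho [] e = matrix_unit_00 (dm [])" "rho [1] e = matrix_unit_00 (dm [1])"
      "\<And>la. la \<in> L \<Longrightarrow> la \<noteq> [] \<Longrightarrow> la \<noteq> [1] \<Longrightarrow> rho la e = 0\<^sub>m (dm la) (dm la)"
    and x: "x \<in> C 2"
  shows "tr (e * x) = (rho [] x $$ (0, 0) + (qnum s (of_nat N) - 1) * rho [1] x $$ (0, 0))
    / (qnum s (of_nat N))\<^sup>2"
proof -
  have qs: "s\<^sup>2 \<noteq> 0" "\<forall>n\<ge>1. (s\<^sup>2) ^ n \<noteq> 1"
    using q s_square by auto
  have sub: "unital_subalgebra smul (C 2)"
    by (rule subalgebra) simp
  note closed = unital_subalgebra_closed[OF sub]
  note trsimps = normalized_trace_simps[OF tr_trace[of 2], simplified]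
  note rep = semisimple_decomposition_blocks[OF C2]
  note rsimps = matrix_rep_simps[OF rep(1)]
  have e: "e \<in> C 2"
    using e_in C_mono[of 1] by (auto simp: numeral_2_eq_2)
  obtain p0 where p0: "minimal_idempotent smul (C 2) p0" "rho [] p0 = matrix_unit_00 (dm [])"
    "\<And>l. l \<in> L \<Longrightarrow> l \<noteq> [] \<Longrightarrow> rho l p0 = 0\<^sub>m (dm l) (dm l)"
    using minimal_idempotent_of_block[OF C2 sub L(1)] by metis
  obtain p1 where p1: "minimal_idempotent smul (C 2) p1" "rho [1] p1 = matrix_unit_00 (dm [1])"
    "\<And>l. l \<in> L \<Longrightarrow> l \<noteq> [1] \<Longrightarrow> rho l p1 = 0\<^sub>m (dm l) (dm l)"
    using minimal_idempotent_of_block[OF C2 sub L(2)] by metis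
  have pC: "p0 \<in> C 2" "p1 \<in> C 2"
    using p0(1) p1(1) by (simp_all add: minimal_idempotent_def)
  note mu = matrix_unit_00_carrier
  have exe: "e * y * e = smul (rho [] y $$ (0, 0)) p0 + smul (rho [1] y $$ (0, 0)) p1"
    if y: "y \<in> C 2" for y
  proof (rule semisimple_eqI[OF C2])
    fix l assume l: "l \<in> L"
    have lhs: "rho l (e * y * e) = rho l e * rho l y * rho l e"
      using e y closed rsimps(4)[OF l] by simp
    have rhs: "rho l (smul (rho [] y $$ (0, 0)) p0 + smul (rho [1] y $$ (0, 0)) p1)
        = rho [] y $$ (0, 0) \<cdot>\<^sub>m rho l p0 + rho [1] y $$ (0, 0) \<cdot>\<^sub>m rho l p1"
      using pC closed rsimps(3,5)[OF l] by simp
    consider "l = []" | "l = [1]" | "l \<noteq> []" "l \<noteq> [1]" by blast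
    then show "rho l (e * y * e) = rho l (smul (rho [] y $$ (0, 0)) p0 + smul (rho [1] y $$ (0, 0)) p1)"
    proof cases
      case 1
      then show ?thesis
        unfolding lhs rhs using p0 p1 l mu[of "dm []"] rep(2)[OF l] rsimps(1)[OF l y]
        by (simp add: e_blocks matrix_unit_00_sandwich del: assoc_mult_mat)
    next
      case 2
      then show ?thesis
        unfolding lhs rhs using p0 p1 l mu[of "dm [1]"] rep(2)[OF l] rsimps(1)[OF l y]
        by (simp add: e_blocks matrix_unit_00_sandwich del: assoc_mult_mat)
    next
      case 3
      then show ?thesis
        unfolding lhs rhs using p0 p1 l rsimps(1)[OF l y]
        by (simp add: e_blocks(3))
    qed
  qed (use e y pC closed in auto)
  have ee: "e * e = e"
  proof (rule semisimple_eqI[OF C2])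
    fix l assume l: "l \<in> L"
    have "rho l (e * e) = rho l e * rho l e"
      using e rsimps(4)[OF l] by simp
    moreover have "rho l e * rho l e = rho l e"
    proof -
      consider "l = []" | "l = [1]" | "l \<noteq> []" "l \<noteq> [1]" by blast
      then show ?thesis
        by cases (use l rep(2)[OF l] in \<open>simp_all add: e_blocks matrix_unit_00_idem\<close>)
    qed
    ultimately show "rho l (e * e) = rho l e"
      by simp
  qed (use e closed in auto)
  have corner: "tr (e * y) = rho [] y $$ (0, 0) * tr p0 + rho [1] y $$ (0, 0) * tr p1"
    if y: "y \<in> C 2" for y
  proof -
    have "tr (e * y) = tr (e * (e * y))"
      by (simp add: mult.assoc[symmetric] ee)
    also have "\<dots> = tr (e * y * e)"
      using e y closed by (intro trsimps(3)) auto
    also have "\<dots> = rho [] y $$ (0, 0) * tr p0 + rho [1] y $$ (0, 0) * tr p1"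
      using y pC closed by (simp add: exe trsimps)
    finally show ?thesis .
  qed
  have "rho [] p0 \<noteq> 0\<^sub>m (dm []) (dm [])"
  proof
    assume "rho [] p0 = 0\<^sub>m (dm []) (dm [])"
    then have "rho [] p0 $$ (0, 0) = 0"
      using rep(2)[OF L(1)] by simp
    then show False
      using rep(2)[OF L(1)] by (simp add: p0(2)) (simp add: matrix_unit_00_def)
  qed
  then have "C_label smul k C Phi 2 p0 []"
    using label[OF p0(1)] by blast
  then have "tr p0 = dimq_sp s k [] / qnum s (of_nat N) ^ 2"
    by (rule tr_C[rotated]) simp
  then have t0: "tr p0 = 1 / (qnum s (of_nat N))\<^sup>2"
    using dimq_sp_empty[OF qs] by simp
  have "tr e = tr p0 + tr p1"
    \<comment> \<open>The case \<open>y = 1\<close>, whose corner entries are 1.\<close>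
    using corner[OF closed(1)] rsimps(2)[OF L(1)] rsimps(2)[OF L(2)] rep(2)[OF L(1)] rep(2)[OF L(2)]
    by simp
  then have t1: "tr p1 = 1 / qnum s (of_nat N) - 1 / (qnum s (of_nat N))\<^sup>2"
    using tr_e t0 by simp
  have "qnum s (of_nat N) \<noteq> 0"
    using N_eq by (intro qnum_of_nat_neq_0[OF qs]) simp
  then show ?thesis
    unfolding corner[OF x] t0 t1 by (simp add: field_simps power2_eq_square)
qed

section \<open>The matrix entries\<close>

text \<open>With \<open>y\<close> the k-th power of q, the identity behind both solutions is
  \<open>[2k+1] (q - 1/q) = A B\<close> for \<open>A = y s - 1/(y s)\<close> and \<open>B = y s + 1/(y s)\<close>. If
  \<open>a = c + 1\<close>, the equation reads \<open>[2k+1] c = [2k] - 1\<close> and B cancels; if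
  \<open>a = c - 1\<close>, it reads \<open>[2k+1] c = [2k] + 1\<close> and A cancels. Neither factor is zero, since q is
  not a root of unity.\<close>

lemma entries_of_trace_equation:
  fixes q s a c :: complex and k :: nat
  assumes s: "s\<^sup>2 = q" and q: "q \<noteq> 0" "\<forall>n\<ge>1. q ^ n \<noteq> 1"
    and eq: "a + (qnum s (of_nat (2 * k + 1)) - 1) * c = qnum s (of_nat (2 * k))"
  shows "a = c + 1 \<Longrightarrow>
      a = qnum s (of_nat k) * (qpow s (1/2) + qpow s (- 1/2)) / qnum s (of_nat k + 1/2) \<and>
      c = qnum s (of_nat k - 1/2) / qnum s (of_nat k + 1/2)"
    and "a = c - 1 \<Longrightarrow>
      a = - (qpow s (1/2) - qpow s (- 1/2)) * (qpow s (of_nat k) - qpow s (- of_nat k))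
            / (qpow s (of_nat k + 1/2) + qpow s (- of_nat k - 1/2)) \<and>
      c = (qpow s (of_nat k - 1/2) + qpow s (- of_nat k + 1/2))
            / (qpow s (of_nat k + 1/2) + qpow s (- of_nat k - 1/2))"
proof -
  define y where "y = q ^ k"
  define D where "D = s\<^sup>2 - inverse (s\<^sup>2)"
  define A where "A = y * s - inverse (y * s)"
  define B where "B = y * s + inverse (y * s)"
  have s0: "s \<noteq> 0" and y0: "y \<noteq> 0"
    using s q(1) by (auto simp: y_def)
  have y_powi: "y = s powi (2 * int k)"
  proof -
    have "s powi int (2 * k) = y"
      by (simp only: power_int_of_nat power_mult y_def s)
    then show ?thesis by simp
  qed
  have half: "qpow s (1/2) = s" "qpow s (- 1/2) = inverse s"
    using qpow_half_int[of "1/2" 1 s] qpow_half_int[of "- 1/2" "- 1" s]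
    by (simp_all add: power_int_minus)
  have whole: "qpow s (of_nat k) = y" "qpow s (- of_nat k) = inverse y"
    using qpow_of_nat[of s k] qpow_uminus[of "of_nat k" "2 * int k" s] by (simp_all add: s y_def)
  have halves: "of_nat k + 1/2 = (of_int (2 * int k + 1) / 2 :: rat)"
    "of_nat k - 1/2 = (of_int (2 * int k - 1) / 2 :: rat)"
    by (simp_all add: add_divide_distrib diff_divide_distrib)
  have plus: "qpow s (of_nat k + 1/2) = y * s"
  proof -
    have "qpow s (of_nat k + 1/2) = s powi (2 * int k + 1)"
      by (rule qpow_half_int[OF halves(1)])
    also have "\<dots> = s powi (2 * int k) * s powi 1"
      by (rule power_int_add) (use s0 in simp)
    finally show ?thesis
      unfolding y_powi power_int_1_right .
  qed
  have minus: "qpow s (of_nat k - 1/2) = y * inverse s"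
  proof -
    have "qpow s (of_nat k - 1/2) = s powi (2 * int k - 1)"
      by (rule qpow_half_int[OF halves(2)])
    also have "\<dots> = s powi (2 * int k) / s powi 1"
      by (rule power_int_diff) (use s0 in simp)
    finally show ?thesis
      unfolding y_powi power_int_1_right divide_inverse .
  qed
  have "- of_nat k - 1/2 = - (of_nat k + 1/2 :: rat)" "- of_nat k + 1/2 = - (of_nat k - 1/2 :: rat)"
    by simp_all
  then have plus': "qpow s (- of_nat k - 1/2) = inverse (y * s)"
    and minus': "qpow s (- of_nat k + 1/2) = inverse y * s"
    by (simp_all only: qpow_uminus[OF halves(1)] qpow_uminus[OF halves(2)] plus minus
        inverse_mult_distrib inverse_inverse_eq)
  have den: "qpow s 1 - qpow s (- 1) = D"
    using qpow_of_nat[of s 1] qpow_uminus[of 1 2 s] by (simp add: D_def)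
  have D0: "D \<noteq> 0"
    using power_neq_inverse_power[OF q, of 1] by (simp add: D_def s)
  have qn_k: "qnum s (of_nat k) = (y - inverse y) / D"
    unfolding qnum_def den whole ..
  have qn_plus: "qnum s (of_nat k + 1/2) = A / D"
    using plus plus' by (simp add: qnum_def den A_def)
  have qn_minus: "qnum s (of_nat k - 1/2) = (y * inverse s - inverse y * s) / D"
    using minus minus' by (simp add: qnum_def den)
  define i z where "i = inverse s" and "z = inverse y"
  have si: "s * i = 1" and yz: "y * z = 1"
    using s0 y0 by (simp_all add: i_def z_def)
  have D_eq: "D = s\<^sup>2 - i\<^sup>2" and A_eq: "A = y * s - z * i" and B_eq: "B = y * s + z * i"
    by (simp_all add: D_def A_def B_def i_def z_def power_inverse)
  have y2: "inverse (y\<^sup>2) = z\<^sup>2"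
    by (simp add: z_def power_inverse)
  have AB: "A * B = q ^ (2 * k + 1) - inverse (q ^ (2 * k + 1))"
  proof -
    have "q ^ (2 * k + 1) = (y * s)\<^sup>2"
      by (simp add: y_def s[symmetric] power_mult_distrib power_mult[symmetric] mult.commute)
    moreover have "inverse ((y * s)\<^sup>2) = (z * i)\<^sup>2"
      by (simp add: i_def z_def power_inverse power_mult_distrib)
    ultimately show ?thesis
      unfolding A_eq B_eq by (simp add: power2_eq_square algebra_simps)
  qed
  then have AB0: "A \<noteq> 0" "B \<noteq> 0"
    using power_neq_inverse_power[OF q, of "2 * k + 1"] by auto
  have N: "qnum s (of_nat (2 * k + 1)) = A * B / D"
    unfolding qnum_of_nat AB D_def s ..
  have N1: "qnum s (of_nat (2 * k)) = (y\<^sup>2 - inverse (y\<^sup>2)) / D"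
    unfolding qnum_of_nat D_def s y_def by (simp add: power_mult[symmetric] mult.commute)
  {
    assume ac: "a = c + 1"
    have "A * B / D * c = (y\<^sup>2 - inverse (y\<^sup>2)) / D - 1"
      using eq unfolding N N1 ac by (simp add: algebra_simps)
    then have "A * B * c = y\<^sup>2 - inverse (y\<^sup>2) - D"
      using D0 by (simp add: divide_simps)
    also have "\<dots> = (y\<^sup>2 - z\<^sup>2) * (s * i) + (i\<^sup>2 - s\<^sup>2) * (y * z)"
      unfolding si yz D_eq y2 by simp
    also have "\<dots> = (y * i - z * s) * B"
      unfolding B_eq by (simp add: algebra_simps power2_eq_square)
    finally have "A * c * B = (y * i - z * s) * B"
      by (simp only: ac_simps)
    then have c: "c = (y * inverse s - inverse y * s) / A"
      using AB0 by (simp add: eq_divide_eq mult.commute i_def z_def)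
    have "a = (y - inverse y) * (s + inverse s) / A"
    proof -
      have "a = (y * inverse s - inverse y * s + A) / A"
        unfolding ac c using AB0 by (simp add: add_divide_distrib)
      also have "y * inverse s - inverse y * s + A = (y - inverse y) * (s + inverse s)"
        by (simp add: A_def distrib_left left_diff_distrib)
      finally show ?thesis .
    qed
    with c show "a = qnum s (of_nat k) * (qpow s (1/2) + qpow s (- 1/2)) / qnum s (of_nat k + 1/2) \<and>
      c = qnum s (of_nat k - 1/2) / qnum s (of_nat k + 1/2)"
      unfolding qn_k qn_plus qn_minus half using D0 by simp
  }
  {
    assume ac: "a = c - 1"
    have "A * B / D * c = (y\<^sup>2 - inverse (y\<^sup>2)) / D + 1"
      using eq unfolding N N1 ac by (simp add: algebra_simps)
    then have "A * B * c = y\<^sup>2 - inverse (y\<^sup>2) + D"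
      using D0 by (simp add: divide_simps)
    also have "\<dots> = (y\<^sup>2 - z\<^sup>2) * (s * i) + (s\<^sup>2 - i\<^sup>2) * (y * z)"
      unfolding si yz D_eq y2 by simp
    also have "\<dots> = (y * i + z * s) * A"
      unfolding A_eq by (simp add: algebra_simps power2_eq_square)
    finally have "B * c * A = (y * i + z * s) * A"
      by (simp only: ac_simps)
    then have c: "c = (y * inverse s + inverse y * s) / B"
      using AB0 by (simp add: eq_divide_eq mult.commute i_def z_def)
    have "a = - (s - inverse s) * (y - inverse y) / B"
    proof -
      have "a = (y * inverse s + inverse y * s - B) / B"
        unfolding ac c using AB0 by (simp add: diff_divide_distrib)
      also have "y * inverse s + inverse y * s - B = - (s - inverse s) * (y - inverse y)"
        by (simp add: B_def algebra_simps)
      finally show ?thesis .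
    qed
    with c show "a = - (qpow s (1/2) - qpow s (- 1/2)) * (qpow s (of_nat k) - qpow s (- of_nat k))
            / (qpow s (of_nat k + 1/2) + qpow s (- of_nat k - 1/2)) \<and>
      c = (qpow s (of_nat k - 1/2) + qpow s (- of_nat k + 1/2))
            / (qpow s (of_nat k + 1/2) + qpow s (- of_nat k - 1/2))"
      unfolding half whole plus plus' minus minus' B_def by simp
  }
qed

theorem lemma2p5:
  fixes smul :: "complex \<Rightarrow> 'a::ring_1 \<Rightarrow> 'a"
    and k N :: nat and q s :: complex
    and C H :: "nat \<Rightarrow> 'a set" and g :: "nat \<Rightarrow> 'a" and e u\<^sub>1 :: 'a
    and sigma Phi :: "nat \<Rightarrow> 'a \<Rightarrow> complex mat"
    and tr :: "'a \<Rightarrow> complex"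
    and L :: "nat list set" and dm :: "nat list \<Rightarrow> nat"
    and rho :: "nat list \<Rightarrow> 'a \<Rightarrow> complex mat"
    and a b c d root_ab root_cd :: complex
  assumes k: "k \<ge> 1" and N: "N = 2 * k + 1"
    and q: "q \<noteq> 0" "\<forall>n\<ge>1. q ^ n \<noteq> 1"
    and tower: "sp_extension_trace smul k N q C g e H sigma Phi s tr"
    and u1: "u\<^sub>1 = smul q 1 - g 1"
    and L: "L = {[], [1], [2]} \<union> (if N \<ge> 5 then {[1, 1]} else {})"
    and dm: "dm = (\<lambda>la. if la = [] \<or> la = [1] then 2 else 1)"
    and C2: "semisimple_decomposition smul (C 2) L dm rho"
    and labels: "\<forall>la\<in>L. \<forall>p. minimal_idempotent smul (C 2) p \<longrightarrow>
      (rho la p \<noteq> 0\<^sub>m (dm la) (dm la) \<longleftrightarrow> C_label smul k C Phi 2 p la)"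
    and e_two_dim: "rho [] e = mat_of_rows_list 2 [[1, 0], [0, 0]]"
      "rho [1] e = mat_of_rows_list 2 [[1, 0], [0, 0]]"
    and e_one_dim: "\<forall>la\<in>L - {[], [1]}. rho la e = 0\<^sub>m 1 1"
    and roots: "root_ab\<^sup>2 = a * b" "root_cd\<^sup>2 = c * d"
    and u1_two_dim: "rho [] u\<^sub>1 = mat_of_rows_list 2 [[a, root_ab], [root_ab, b]]"
      "rho [1] u\<^sub>1 = mat_of_rows_list 2 [[c, root_cd], [root_cd, d]]"
    and markov: "\<forall>n\<ge>1. \<forall>x\<in>C n. tr (x * g n) = tr x * tr (g n)"
  shows "(a = c + 1 \<longrightarrow>
            a = qnum s (of_nat k) * (qpow s (1/2) + qpow s (- 1/2)) / qnum s (of_nat k + 1/2) \<and>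
            c = qnum s (of_nat k - 1/2) / qnum s (of_nat k + 1/2)) \<and>
         (a = c - 1 \<longrightarrow>
            a = - (qpow s (1/2) - qpow s (- 1/2)) * (qpow s (of_nat k) - qpow s (- of_nat k))
                  / (qpow s (of_nat k + 1/2) + qpow s (- of_nat k - 1/2)) \<and>
            c = (qpow s (of_nat k - 1/2) + qpow s (- of_nat k + 1/2))
                  / (qpow s (of_nat k + 1/2) + qpow s (- of_nat k - 1/2)))"
proof -
  interpret sp_extension_trace smul k N q C g e H sigma Phi s tr
    by (rule tower)
  have qs: "s\<^sup>2 \<noteq> 0" "\<forall>n\<ge>1. (s\<^sup>2) ^ n \<noteq> 1"
    using q s_square by auto
  have sub: "unital_subalgebra smul (C 2)"
    by (rule subalgebra) simp
  note closed = unital_subalgebra_closed[OF sub]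
  note trsimps = normalized_trace_simps[OF tr_trace[of 2], simplified]
  have e: "e \<in> C 2"
    using e_in C_mono[of 1] by (auto simp: numeral_2_eq_2)
  have g: "g 1 \<in> C 2"
    by (rule g_in) auto
  have u_eq: "u\<^sub>1 = smul q 1 + smul (- 1) (g 1)"
    unfolding u1 by (rule minus_eq_scale)
  have u: "u\<^sub>1 \<in> C 2"
    unfolding u_eq using g closed by blast
  have unit: "mat_of_rows_list 2 [[1, 0], [0, 0]] = matrix_unit_00 2"
    by (rule eq_matI) (auto simp: mat_of_rows_list_def matrix_unit_00_def less_2_cases_iff)
  have corner: "tr (e * u\<^sub>1) = (a + (qnum s (of_nat N) - 1) * c) / (qnum s (of_nat N))\<^sup>2"
  proof -
    have "tr (e * u\<^sub>1) = (rho [] u\<^sub>1 $$ (0, 0) + (qnum s (of_nat N) - 1) * rho [1] u\<^sub>1 $$ (0, 0))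
        / (qnum s (of_nat N))\<^sup>2"
    proof (rule trace_corner[OF q _ _ C2 _ _ _ _ u])
      show "C_label smul k C Phi 2 p []"
        if "minimal_idempotent smul (C 2) p" "rho [] p \<noteq> 0\<^sub>m (dm []) (dm [])" for p
        using labels that L by blast
    qed (use L dm e_two_dim e_one_dim unit in auto)
    then show ?thesis
      unfolding u1_two_dim by (simp add: mat_of_rows_list_def)
  qed
  have "tr (e * u\<^sub>1) = tr e * tr u\<^sub>1"
  proof -
    have "e * u\<^sub>1 = smul q e - e * g 1"
      by (simp only: u1 right_diff_distrib scale_mult_right mult_1_right)
    moreover have "tr (smul q e - e * g 1) = q * tr e - tr (e * g 1)"
      using trace_diff[OF sub tr_trace[of 2], of "smul q e" "e * g 1"] e g closed
      by (simp add: trsimps)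
    ultimately have "tr (e * u\<^sub>1) = q * tr e - tr (e * g 1)"
      by simp
    moreover have "tr (e * g 1) = tr e * tr (g 1)"
      using markov e_in by auto
    moreover have "tr u\<^sub>1 = q - tr (g 1)"
      using trace_diff[OF sub tr_trace[of 2], of "smul q 1" "g 1"] g closed
      by (simp add: trsimps u1)
    ultimately show ?thesis
      by (simp only: right_diff_distrib mult.commute)
  qed
  also have "\<dots> = qnum s (of_nat (N - 1)) / (qnum s (of_nat N))\<^sup>2"
    by (simp add: tr_e u1 trace_u1[OF k q, simplified] power2_eq_square)
  finally have "(a + (qnum s (of_nat N) - 1) * c) / (qnum s (of_nat N))\<^sup>2
      = qnum s (of_nat (N - 1)) / (qnum s (of_nat N))\<^sup>2"
    unfolding corner .
  moreover have "qnum s (of_nat N) \<noteq> 0"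
    using N by (intro qnum_of_nat_neq_0[OF qs]) simp
  ultimately have "a + (qnum s (of_nat N) - 1) * c = qnum s (of_nat (N - 1))"
    by simp
  then have "a + (qnum s (of_nat (2 * k + 1)) - 1) * c = qnum s (of_nat (2 * k))"
    by (simp only: N add_diff_cancel_right')
  from entries_of_trace_equation[OF s_square q this] show ?thesis
    by blast
qed

end
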